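(* There is a deterministic algorithm which, given only the vertex set $V$ ($|V|=n$) of an unknown directed rooted tree $T=(V,E)$ of height $h$ whose maximum degree is bounded by a fixed constant $d$, and given access to path queries on $T$, determines the root $r$ and the edge set $E$ of $T$ using $O(nh)$ path queries.
   Context: A directed rooted tree $T=(V,E)$ with root $r$ is a tree all of whose edges are oriented away from $r$. Its height is the maximum number of edges on a directed path from $r$ to a leaf. The degree of a vertex is its in-degree plus its out-degree. A path query $\mathsf{path}(u,v)$, for $u,v\in V$, returns $1$ if there is a directed path from $u$ to $v$ in $T$ and $0$ otherwise. The learning algorithm initially knows only $V$ and obtains information about $E$ only through path queries; its cost is the total number of path queries it issues. *)

theory Defs
  imports Complex_Main "Graph_Theory.Digraph_Component"
begin

section \<open>Directed rooted trees\<close>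

text \<open>
  The constant \<open>tree\<close> of the graph library only forbids directed cycles, so on a digraph it
  describes weakly connected acyclic digraphs rather than orientations of trees.  Here the
  underlying undirected graph \<open>mk_symmetric T\<close> is required to be a tree.  Undirected graphs are
  represented as symmetric digraphs, in which traversing an edge back and forth is a cycle of
  length 2; the cycles of the undirected graph are those of length at least 3.
\<close>

definition underlying_tree :: "'v pair_pre_digraph \<Rightarrow> bool" where
  "underlying_tree T \<longleftrightarrow>
     Digraph_Component.connected (with_proj T) \<and>
     \<not> (\<exists>p. pre_digraph.cycle (with_proj (mk_symmetric (with_proj T))) p \<and> length p \<ge> 3)"

text \<open>
  An edge \<open>(u, v)\<close> points away from \<open>r\<close> if the path from \<open>r\<close> to \<open>v\<close> in the underlying undirected
  tree traverses this edge in the direction from \<open>u\<close> to \<open>v\<close>.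
\<close>

definition oriented_away :: "'v pair_pre_digraph \<Rightarrow> 'v \<Rightarrow> bool" where
  "oriented_away T r \<longleftrightarrow>
     (\<forall>(u, v) \<in> parcs T. \<forall>p.
        pre_digraph.apath (with_proj (mk_symmetric (with_proj T))) r p v \<longrightarrow> (u, v) \<in> set p)"

definition directed_rooted_tree :: "'v pair_pre_digraph \<Rightarrow> 'v \<Rightarrow> bool" where
  "directed_rooted_tree T r \<longleftrightarrow>
     pair_digraph T \<and> r \<in> pverts T \<and> underlying_tree T \<and> oriented_away T r"

definition leaf :: "'v pair_pre_digraph \<Rightarrow> 'v \<Rightarrow> bool" where
  "leaf T v \<longleftrightarrow> v \<in> pverts T \<and> out_degree (with_proj T) v = 0"

definition height :: "'v pair_pre_digraph \<Rightarrow> 'v \<Rightarrow> nat" where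
  "height T r = Max {length p | p v. leaf T v \<and> pre_digraph.apath (with_proj T) r p v}"

definition degree :: "'v pair_pre_digraph \<Rightarrow> 'v \<Rightarrow> nat" where
  "degree T v = in_degree (with_proj T) v + out_degree (with_proj T) v"

section \<open>Deterministic algorithms using path queries\<close>

text \<open>The path of length 0 counts, so a query \<open>path(v, v)\<close> is answered positively.\<close>

definition path_query :: "'v pair_pre_digraph \<Rightarrow> 'v \<Rightarrow> 'v \<Rightarrow> bool" where
  "path_query T u v \<longleftrightarrow> u \<rightarrow>\<^sup>*\<^bsub>with_proj T\<^esub> v"

text \<open>
  A deterministic adaptive computation is a decision tree: it either halts, announcing a root
  and an edge set, or issues one query and continues depending on the answer.
\<close>

datatype 'v learner =
  Output 'v "'v rel"
| Query 'v 'v "bool \<Rightarrow> 'v learner"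

primrec outcome :: "('v \<Rightarrow> 'v \<Rightarrow> bool) \<Rightarrow> 'v learner \<Rightarrow> 'v \<times> 'v rel" where
  "outcome answer (Output r E) = (r, E)"
| "outcome answer (Query u v k) = outcome answer (k (answer u v))"

text \<open>The sequence of all queries issued in a run, with repetitions.\<close>

primrec queries :: "('v \<Rightarrow> 'v \<Rightarrow> bool) \<Rightarrow> 'v learner \<Rightarrow> ('v \<times> 'v) list" where
  "queries answer (Output r E) = []"
| "queries answer (Query u v k) = (u, v) # queries answer (k (answer u v))"

end

theory Submission
  imports Defs
begin

text \<open>
  Passing once through a list of vertices and replacing the current candidate by every proper
  ancestor met on the way ends in a vertex without proper ancestors in the list.  This finds the
  root, and then a child \<open>c\<close> of \<open>p\<close> in any set \<open>S\<close> consisting of the subtrees of some children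
  of \<open>p\<close>.  Querying \<open>path(c, v)\<close> for all \<open>v \<in> S\<close> separates the subtree of \<open>c\<close> from the rest,
  and both parts are treated recursively.  A vertex \<open>v\<close> takes part in the splitting
  at \<open>c\<close> only if the parent of \<open>c\<close> is a proper ancestor of \<open>v\<close>.  There are at most \<open>d h\<close> such \<open>c\<close>
  for every \<open>v\<close>, hence \<open>O(n d h)\<close> queries overall.
\<close>

section \<open>Learners in continuation-passing style\<close>

text \<open>Quantifying over all continuations \<open>k\<close> assigns to a program fragment a
  result and a fixed query log, so correctness and cost compose by concatenating logs.\<close>

definition computes ::
  "('v \<Rightarrow> 'v \<Rightarrow> bool) \<Rightarrow> (('a \<Rightarrow> 'v learner) \<Rightarrow> 'v learner) \<Rightarrow> 'a \<Rightarrow> ('v \<times> 'v) list \<Rightarrow> bool" where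
  "computes ans m x qs \<longleftrightarrow>
     (\<forall>k. outcome ans (m k) = outcome ans (k x) \<and> queries ans (m k) = qs @ queries ans (k x))"

lemma computes_return: "computes ans (\<lambda>k. k x) x []"
  by (simp add: computes_def)

lemma computes_query: "computes ans (Query u v) (ans u v) [(u, v)]"
  by (simp add: computes_def)

lemma computes_bind:
  assumes "computes ans m x qs" and "computes ans (f x) y qs'"
  shows "computes ans (\<lambda>k. m (\<lambda>x. f x k)) y (qs @ qs')"
  using assms by (simp add: computes_def)

section \<open>The learner and its subroutines\<close>

primrec find_top :: "'v \<Rightarrow> 'v list \<Rightarrow> ('v \<Rightarrow> 'v learner) \<Rightarrow> 'v learner" where
  "find_top c [] = (\<lambda>k. k c)"
| "find_top c (x # xs) = (\<lambda>k. Query x c (\<lambda>b. find_top (if b then x else c) xs k))"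

primrec find_below :: "'v \<Rightarrow> 'v list \<Rightarrow> ('v list \<Rightarrow> 'v learner) \<Rightarrow> 'v learner" where
  "find_below c [] = (\<lambda>k. k [])"
| "find_below c (x # xs) =
     (\<lambda>k. Query c x (\<lambda>b. find_below c xs (\<lambda>ys. k (if b then x # ys else ys))))"

text \<open>The first argument bounds the recursion depth; \<open>length S\<close> always suffices.\<close>

primrec learn_forest :: "nat \<Rightarrow> 'v \<Rightarrow> 'v list \<Rightarrow> ('v rel \<Rightarrow> 'v learner) \<Rightarrow> 'v learner" where
  "learn_forest 0 p S = (\<lambda>k. k {})"
| "learn_forest (Suc n) p S = (\<lambda>k. if S = [] then k {} else
     find_top (hd S) (tl S) (\<lambda>c.
     find_below c (remove1 c S) (\<lambda>D.
     learn_forest n c D (\<lambda>E\<^sub>1.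
     learn_forest n p (filter (\<lambda>x. x \<notin> set D) (remove1 c S)) (\<lambda>E\<^sub>2.
     k (insert (p, c) (E\<^sub>1 \<union> E\<^sub>2)))))))"

text \<open>The enumeration is chosen from \<open>V\<close> alone, so the learner is deterministic
  and knows nothing about the edges beyond the answers it gets.\<close>

definition learn_tree :: "'v set \<Rightarrow> 'v learner" where
  "learn_tree V =
     (let xs = SOME xs. set xs = V \<and> distinct xs in
      find_top (hd xs) (tl xs) (\<lambda>r.
      learn_forest (length xs) r (remove1 r xs) (Output r)))"

lemma computes_find_below:
  "computes ans (find_below c xs) (filter (ans c) xs) (map (Pair c) xs)"
  by (induction xs) (simp_all add: computes_def)

section \<open>Correctness and cost on a forest with answered queries\<close>

text \<open>Separates the analysis of the learner from the digraph representation. A root reaching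
  every vertex is assumed only in \<open>learn_tree_correct\<close>.\<close>

locale answered_forest =
  fixes V :: "'v set" and E :: "'v rel" and ans :: "'v \<Rightarrow> 'v \<Rightarrow> bool"
  assumes arcs_in_V: "E \<subseteq> V \<times> V"
    and acyclic: "acyclic E"
    and parent_unique: "(u, v) \<in> E \<Longrightarrow> (u', v) \<in> E \<Longrightarrow> u = u'"
    and ans_iff: "u \<in> V \<Longrightarrow> v \<in> V \<Longrightarrow> ans u v \<longleftrightarrow> (u, v) \<in> E\<^sup>*"
begin

lemma antisym_reach: "(u, v) \<in> E\<^sup>* \<Longrightarrow> (v, u) \<in> E\<^sup>* \<Longrightarrow> u = v"
  using acyclic acyclic_impl_antisym_rtrancl antisymD by metis

text \<open>Candidates only move upwards, so the result \<open>t\<close> reaches the initial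
  \<open>c\<close>. This clause carries the induction: with it, no discarded vertex other than
  \<open>t\<close> can lie above \<open>t\<close>.\<close>

lemma computes_find_top:
  assumes "c \<in> V" and "set xs \<subseteq> V"
  shows "\<exists>t qs. computes ans (find_top c xs) t qs \<and> t \<in> insert c (set xs) \<and> (t, c) \<in> E\<^sup>* \<and>
    (\<forall>y \<in> insert c (set xs). (y, t) \<in> E\<^sup>* \<longrightarrow> y = t) \<and>
    set qs \<subseteq> insert c (set xs) \<times> insert c (set xs) \<and> length qs = length xs"
  using assms
proof (induction xs arbitrary: c)
  case Nil
  show ?case
    by (rule exI[of _ c], rule exI[of _ "[]"]) (simp add: computes_return)
next
  case (Cons x xs)
  let ?c = "if ans x c then x else c"
  have "?c \<in> V" "set xs \<subseteq> V" using Cons.prems by auto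
  from Cons.IH[OF this] obtain t qs where
    t: "computes ans (find_top ?c xs) t qs" "t \<in> insert ?c (set xs)" "(t, ?c) \<in> E\<^sup>*"
       "\<forall>y \<in> insert ?c (set xs). (y, t) \<in> E\<^sup>* \<longrightarrow> y = t"
       "set qs \<subseteq> insert ?c (set xs) \<times> insert ?c (set xs)" "length qs = length xs"
    by blast
  have iff: "ans x c \<longleftrightarrow> (x, c) \<in> E\<^sup>*" using Cons.prems ans_iff by simp
  have "computes ans (find_top c (x # xs)) t ([(x, c)] @ qs)"
    using computes_bind[OF computes_query[of ans x c],
        of "\<lambda>b. find_top (if b then x else c) xs"] t(1) by simp
  moreover have "t \<in> insert c (set (x # xs))" using t(2) by (auto split: if_splits)
  moreover have tc: "(t, c) \<in> E\<^sup>*" using t(3) iff by (auto split: if_splits)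
  moreover have "\<forall>y \<in> insert c (set (x # xs)). (y, t) \<in> E\<^sup>* \<longrightarrow> y = t"
  proof (intro ballI impI)
    fix y assume y: "y \<in> insert c (set (x # xs))" "(y, t) \<in> E\<^sup>*"
    show "y = t"
    proof (cases "y \<in> insert ?c (set xs)")
      case True
      then show ?thesis using t(4) y(2) by blast
    next
      case False
      \<comment> \<open>Here \<open>y\<close> is dropped in this very step. It is either the
        replaced \<open>c\<close>, equal to \<open>t\<close> by antisymmetry, or the rejected
        \<open>x\<close>, which would reach \<open>c\<close> through \<open>t\<close>.\<close>
      show ?thesis
      proof (cases "ans x c")
        case True
        then have "y = c" using False y(1) by auto
        then show ?thesis using antisym_reach y(2) tc by blast
      next
        case nans: False
        then have "y = x" using False y(1) by auto
        then have "(x, c) \<in> E\<^sup>*" using y(2) tc by auto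
        then show ?thesis using nans iff by blast
      qed
    qed
  qed
  moreover have "set ([(x, c)] @ qs) \<subseteq> insert c (set (x # xs)) \<times> insert c (set (x # xs))"
    using t(5) by (auto split: if_splits)
  moreover have "length ([(x, c)] @ qs) = length (x # xs)" using t(6) by simp
  ultimately show ?case by blast
qed

section \<open>Splitting a hanging forest, and the potential that pays for it\<close>

text \<open>The pivots \<open>c\<close> in whose splitting \<open>v\<close> may still take part.
  Restricting to \<open>S\<close> makes the sum of these cardinalities a potential that drops as the
  recursion shrinks \<open>S\<close>.\<close>

definition charged :: "'v set \<Rightarrow> 'v \<Rightarrow> 'v set" where
  "charged S v = {c \<in> S. \<exists>q. (q, c) \<in> E \<and> (q, v) \<in> E\<^sup>+}"

text \<open>\<open>S\<close> consists of the full subtrees of some of the children of \<open>p\<close>.\<close>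

definition hangs_below :: "'v \<Rightarrow> 'v set \<Rightarrow> bool" where
  "hangs_below p S \<longleftrightarrow> S \<subseteq> V \<and> (\<forall>x \<in> S. (p, x) \<in> E\<^sup>+) \<and>
     (\<forall>x \<in> S. \<forall>q. (q, x) \<in> E \<longrightarrow> q = p \<or> q \<in> S) \<and> (\<forall>x \<in> S. \<forall>y. (x, y) \<in> E \<longrightarrow> y \<in> S)"

lemma reach_parent:
  assumes "(u, v) \<in> E\<^sup>*" and "u \<noteq> v" and "(q, v) \<in> E"
  shows "(u, q) \<in> E\<^sup>*"
  using assms parent_unique by (metis rtranclE)

lemma not_self_below: "(u, u) \<notin> E\<^sup>+"
  using acyclic by (simp add: acyclic_def)

text \<open>The parent of a topmost \<open>c\<close> cannot lie in \<open>S\<close>, so it is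
  \<open>p\<close>. By unique parents, a path from \<open>c\<close> to another vertex passes through
  that vertex's parent; hence membership in \<open>D\<close> or \<open>R\<close> is inherited along
  edges that avoid \<open>c\<close>.\<close>

lemma hangs_below_split:
  assumes S: "hangs_below p S" and c: "c \<in> S" and top: "\<forall>y \<in> S. (y, c) \<in> E\<^sup>* \<longrightarrow> y = c"
  defines "D \<equiv> {x \<in> S - {c}. (c, x) \<in> E\<^sup>*}" and "R \<equiv> {x \<in> S - {c}. (c, x) \<notin> E\<^sup>*}"
  shows "(p, c) \<in> E" and "hangs_below c D" and "hangs_below p R"
proof -
  have SV: "S \<subseteq> V" and below: "\<And>x. x \<in> S \<Longrightarrow> (p, x) \<in> E\<^sup>+"
    and up: "\<And>x q. x \<in> S \<Longrightarrow> (q, x) \<in> E \<Longrightarrow> q = p \<or> q \<in> S"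
    and down: "\<And>x y. x \<in> S \<Longrightarrow> (x, y) \<in> E \<Longrightarrow> y \<in> S"
    using S by (auto simp: hangs_below_def)
  have no_p: "p \<notin> S" using below not_self_below by blast
  obtain q where q: "(p, q) \<in> E\<^sup>*" "(q, c) \<in> E" using below[OF c] by (meson tranclD2)
  have "q \<notin> S"
  proof
    assume "q \<in> S"
    then have "q = c" using top q(2) by blast
    then show False using q(2) not_self_below by blast
  qed
  then show pc: "(p, c) \<in> E" using up[OF c q(2)] q(2) by blast
  have no_loop: "(x, x) \<notin> E" for x using not_self_below by blast
  show "hangs_below c D"
    unfolding hangs_below_def
  proof (intro conjI ballI allI impI)
    show "D \<subseteq> V" using SV D_def by blast
  next
    fix x assume "x \<in> D"
    then show "(c, x) \<in> E\<^sup>+" unfolding D_def by (auto simp: rtrancl_eq_or_trancl)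
  next
    fix x q assume x: "x \<in> D" and qx: "(q, x) \<in> E"
    then have cq: "(c, q) \<in> E\<^sup>*" using reach_parent unfolding D_def by blast
    \<comment> \<open>Otherwise \<open>c\<close> would reach its own parent \<open>p\<close>,
      closing a cycle.\<close>
    have "q \<noteq> p"
      using cq pc not_self_below by (metis rtrancl_into_trancl1)
    then have "q \<in> S" using up qx x unfolding D_def by blast
    then show "q = c \<or> q \<in> D" using cq unfolding D_def by blast
  next
    fix x y assume x: "x \<in> D" and xy: "(x, y) \<in> E"
    then have "y \<in> S" "(c, y) \<in> E\<^sup>+" using down unfolding D_def by auto
    then show "y \<in> D" using not_self_below unfolding D_def by auto
  qed
  show "hangs_below p R"
    unfolding hangs_below_def
  proof (intro conjI ballI allI impI)
    show "R \<subseteq> V" using SV R_def by blast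
  next
    fix x assume "x \<in> R"
    then show "(p, x) \<in> E\<^sup>+" using below unfolding R_def by blast
  next
    fix x q assume x: "x \<in> R" and qx: "(q, x) \<in> E"
    then have "(c, q) \<notin> E\<^sup>*" unfolding R_def by (auto intro: rtrancl_into_rtrancl)
    then show "q = p \<or> q \<in> R" using up qx x unfolding R_def by blast
  next
    fix x y assume x: "x \<in> R" and xy: "(x, y) \<in> E"
    then have yS: "y \<in> S" using down unfolding R_def by blast
    \<comment> \<open>The only parent of \<open>c\<close> is \<open>p\<close>, which is outside
      \<open>S\<close>, while \<open>x\<close> is in \<open>S\<close>.\<close>
    have "y \<noteq> c" using parent_unique xy pc no_p x unfolding R_def by blast
    moreover have "(c, y) \<notin> E\<^sup>*"
      using reach_parent[of c y x] \<open>y \<noteq> c\<close> xy x unfolding R_def by blast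
    ultimately show "y \<in> R" using yS unfolding R_def by blast
  qed
qed

text \<open>Every \<open>v\<close> in \<open>S\<close> is charged for \<open>c\<close>, but
  \<open>c\<close> is in neither part. So each vertex loses at least one unit, and the potential
  drops by at least \<open>card S\<close>.\<close>

lemma sum_charged_split:
  assumes fin: "finite S" and S: "hangs_below p S" and c: "c \<in> S" and pc: "(p, c) \<in> E"
  defines "D \<equiv> {x \<in> S - {c}. (c, x) \<in> E\<^sup>*}" and "R \<equiv> {x \<in> S - {c}. (c, x) \<notin> E\<^sup>*}"
  shows "card S + (\<Sum>v\<in>D. card (charged D v)) + (\<Sum>v\<in>R. card (charged R v))
    \<le> (\<Sum>v\<in>S. card (charged S v))"
proof -
  have finC: "finite (charged S v)" for v using fin by (simp add: charged_def)
  have cS: "c \<in> charged S v" if "v \<in> S" for v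
    using that S c pc by (auto simp: charged_def hangs_below_def)
  have le: "Suc (card (charged S' v)) \<le> card (charged S v)"
    if "S' \<subseteq> S" "c \<notin> S'" "v \<in> S" for S' v
  proof -
    have "insert c (charged S' v) \<subseteq> charged S v"
      using that cS by (auto simp: charged_def)
    then have "card (insert c (charged S' v)) \<le> card (charged S v)"
      using finC card_mono by blast
    moreover have "finite (charged S' v)" "c \<notin> charged S' v"
      using that(1,2) finite_subset[OF that(1) fin] by (simp_all add: charged_def)
    ultimately show ?thesis by simp
  qed
  have split: "S = insert c (D \<union> R)" "D \<inter> R = {}" "c \<notin> D \<union> R" "finite D" "finite R"
    "D \<subseteq> S" "R \<subseteq> S" "c \<notin> D" "c \<notin> R"
    using c fin by (auto simp: D_def R_def)
  \<comment> \<open>The pivot \<open>c\<close> goes into neither part; the empty set as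
    \<open>S'\<close> yields its unit.\<close>
  have "Suc 0 \<le> card (charged S c)" using le[of "{}" c] c by simp
  moreover have "(\<Sum>v\<in>D. Suc (card (charged D v))) \<le> (\<Sum>v\<in>D. card (charged S v))"
    using split by (intro sum_mono le) auto
  moreover have "(\<Sum>v\<in>R. Suc (card (charged R v))) \<le> (\<Sum>v\<in>R. card (charged S v))"
    using split by (intro sum_mono le) auto
  moreover have "(\<Sum>v\<in>S. f v) = f c + ((\<Sum>v\<in>D. f v) + (\<Sum>v\<in>R. f v))" for f :: "'v \<Rightarrow> nat"
    using split by (metis finite_UnI sum.insert sum.union_disjoint)
  moreover have "card S = 1 + (card D + card R)"
    using split by (metis card_Un_disjoint card_insert_disjoint finite_UnI plus_1_eq_Suc)
  ultimately show ?thesis by (simp add: sum.distrib sum_Suc)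
qed

text \<open>Finding the pivot and testing against it cost \<open>length S - 1\<close> queries each;
  twice the potential drop covers both. Removing the pivot leaves both parts within the smaller
  depth bound.\<close>

lemma computes_learn_forest:
  assumes "distinct S" and "length S \<le> n" and "hangs_below p (set S)"
  shows "\<exists>qs. computes ans (learn_forest n p S) (E \<inter> UNIV \<times> set S) qs \<and>
    set qs \<subseteq> set S \<times> set S \<and> length qs \<le> 2 * (\<Sum>v\<in>set S. card (charged (set S) v))"
  using assms
proof (induction n arbitrary: p S)
  case 0
  then show ?case by (intro exI[of _ "[]"]) (simp add: computes_return)
next
  case (Suc n)
  show ?case
  proof (cases "S = []")
    case True
    then show ?thesis by (intro exI[of _ "[]"]) (simp add: computes_return)
  next
    case False
    have SV: "set S \<subseteq> V" using Suc.prems by (simp add: hangs_below_def)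
    have hdtl: "insert (hd S) (set (tl S)) = set S"
      using False by (metis list.collapse list.simps(15))
    have "hd S \<in> V" "set (tl S) \<subseteq> V" using SV hdtl by auto
    from computes_find_top[OF this] obtain c qs\<^sub>1 where
      c: "computes ans (find_top (hd S) (tl S)) c qs\<^sub>1" "c \<in> set S"
         "\<forall>y \<in> set S. (y, c) \<in> E\<^sup>* \<longrightarrow> y = c"
      and qs\<^sub>1: "set qs\<^sub>1 \<subseteq> set S \<times> set S" "length qs\<^sub>1 = length (tl S)"
      unfolding hdtl by blast
    define S' where "S' = remove1 c S"
    define D where "D = filter (ans c) S'"
    define R where "R = filter (\<lambda>x. x \<notin> set D) S'"
    have S': "set S' = set S - {c}" "distinct S'" "length S = Suc (length S')"
      using Suc.prems(1) c(2) False
      by (auto simp: S'_def set_remove1_eq length_remove1 distinct_remove1)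
    have setD: "set D = {x \<in> set S - {c}. (c, x) \<in> E\<^sup>*}"
      using c(2) SV ans_iff by (auto simp: D_def S')
    have setR: "set R = {x \<in> set S - {c}. (c, x) \<notin> E\<^sup>*}"
      using setD by (auto simp: R_def S')
    note split = hangs_below_split[OF Suc.prems(3) c(2,3), folded setD setR]
    have len: "length D \<le> n" "length R \<le> n" and dist: "distinct D" "distinct R"
      using Suc.prems(2) S' le_trans[OF length_filter_le] by (auto simp: D_def R_def)
    obtain qs\<^sub>2 where qs\<^sub>2: "computes ans (learn_forest n c D) (E \<inter> UNIV \<times> set D) qs\<^sub>2"
      "set qs\<^sub>2 \<subseteq> set D \<times> set D" "length qs\<^sub>2 \<le> 2 * (\<Sum>v\<in>set D. card (charged (set D) v))"
      using Suc.IH[OF dist(1) len(1) split(2)] by blast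
    obtain qs\<^sub>3 where qs\<^sub>3: "computes ans (learn_forest n p R) (E \<inter> UNIV \<times> set R) qs\<^sub>3"
      "set qs\<^sub>3 \<subseteq> set R \<times> set R" "length qs\<^sub>3 \<le> 2 * (\<Sum>v\<in>set R. card (charged (set R) v))"
      using Suc.IH[OF dist(2) len(2) split(3)] by blast
    let ?qs = "qs\<^sub>1 @ map (Pair c) S' @ qs\<^sub>2 @ qs\<^sub>3"
    \<comment> \<open>By unique parents, \<open>(p, c)\<close> is the only edge entering
      \<open>c\<close>; all other edges into \<open>S\<close> enter \<open>D\<close> or
      \<open>R\<close>.\<close>
    have arcs: "insert (p, c) (E \<inter> UNIV \<times> set D \<union> E \<inter> UNIV \<times> set R) = E \<inter> UNIV \<times> set S"
      using split(1) parent_unique c(2) unfolding setD setR by blast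
    have "computes ans (find_below c S') D (map (Pair c) S')"
      unfolding D_def by (rule computes_find_below)
    with c(1) qs\<^sub>2(1) qs\<^sub>3(1)
    have "computes ans (learn_forest (Suc n) p S) (E \<inter> UNIV \<times> set S) ?qs"
      using False arcs by (simp add: computes_def flip: S'_def R_def)
    moreover have "set ?qs \<subseteq> set S \<times> set S"
      using qs\<^sub>1(1) qs\<^sub>2(2) qs\<^sub>3(2) c(2) S'(1) unfolding setD setR by auto
    moreover have "card (set S) = length S"
      using Suc.prems(1) by (rule distinct_card)
    then have "length ?qs \<le> 2 * (\<Sum>v\<in>set S. card (charged (set S) v))"
      using sum_charged_split[OF _ Suc.prems(3) c(2) split(1), folded setD setR]
        qs\<^sub>1(2) qs\<^sub>2(3) qs\<^sub>3(3) S'(3) by simp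
    ultimately show ?thesis by blast
  qed
qed

lemma learn_tree_correct:
  assumes fin: "finite V" and r: "r \<in> V" and reach: "\<And>v. v \<in> V \<Longrightarrow> (r, v) \<in> E\<^sup>*"
  shows "outcome ans (learn_tree V) = (r, E)"
    and "set (queries ans (learn_tree V)) \<subseteq> V \<times> V"
    and "length (queries ans (learn_tree V)) \<le> (card V - 1) + 2 * (\<Sum>v\<in>V. card (charged V v))"
proof -
  define xs where "xs = (SOME xs. set xs = V \<and> distinct xs)"
  have xs: "set xs = V" "distinct xs"
    using someI_ex[OF finite_distinct_list[OF fin]] by (simp_all add: xs_def)
  then have ne: "xs \<noteq> []" using r by auto
  have hdtl: "insert (hd xs) (set (tl xs)) = V"
    using ne xs(1) by (metis list.collapse list.simps(15))
  then have "hd xs \<in> V" "set (tl xs) \<subseteq> V" by auto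
  from computes_find_top[OF this] obtain t qs\<^sub>1 where
    t: "computes ans (find_top (hd xs) (tl xs)) t qs\<^sub>1" "t \<in> V"
       "\<forall>y \<in> V. (y, t) \<in> E\<^sup>* \<longrightarrow> y = t"
    and qs\<^sub>1: "set qs\<^sub>1 \<subseteq> V \<times> V" "length qs\<^sub>1 = length (tl xs)"
    unfolding hdtl by blast
  \<comment> \<open>The root reaches \<open>t\<close>, and nothing else in \<open>V\<close> lies
    above \<open>t\<close>.\<close>
  have "t = r" using t r reach by blast
  have S: "set (remove1 r xs) = V - {r}" using xs by simp
  have no_parent: "(q, r) \<notin> E" for q
  proof
    assume qr: "(q, r) \<in> E"
    then have "(r, q) \<in> E\<^sup>*" using reach arcs_in_V by blast
    then show False using qr not_self_below by (metis rtrancl_into_trancl1)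
  qed
  have "hangs_below r (set (remove1 r xs))"
    unfolding S hangs_below_def
    using reach arcs_in_V no_parent by (auto simp: rtrancl_eq_or_trancl)
  moreover have "distinct (remove1 r xs)" "length (remove1 r xs) \<le> length xs"
    using xs(2) by (simp_all add: length_remove1)
  ultimately obtain qs\<^sub>2 where qs\<^sub>2:
    "computes ans (learn_forest (length xs) r (remove1 r xs)) (E \<inter> UNIV \<times> (V - {r})) qs\<^sub>2"
    "set qs\<^sub>2 \<subseteq> (V - {r}) \<times> (V - {r})"
    "length qs\<^sub>2 \<le> 2 * (\<Sum>v\<in>V - {r}. card (charged (V - {r}) v))"
    using computes_learn_forest[of "remove1 r xs" "length xs" r] unfolding S by blast
  have E: "E \<inter> UNIV \<times> (V - {r}) = E" using arcs_in_V no_parent by auto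
  have tree: "learn_tree V = find_top (hd xs) (tl xs) (\<lambda>r.
      learn_forest (length xs) r (remove1 r xs) (Output r))"
    by (simp add: learn_tree_def Let_def xs_def)
  show "outcome ans (learn_tree V) = (r, E)"
    using t(1) qs\<^sub>2(1) \<open>t = r\<close> by (simp add: tree computes_def E)
  have q: "queries ans (learn_tree V) = qs\<^sub>1 @ qs\<^sub>2"
    using t(1) qs\<^sub>2(1) \<open>t = r\<close> by (simp add: tree computes_def)
  then show "set (queries ans (learn_tree V)) \<subseteq> V \<times> V"
    using qs\<^sub>1 qs\<^sub>2 by auto
  \<comment> \<open>Passing from \<open>V - {r}\<close> to \<open>V\<close> only weakens the bound
    and removes the root from it.\<close>
  have "(\<Sum>v\<in>V - {r}. card (charged (V - {r}) v)) \<le> (\<Sum>v\<in>V - {r}. card (charged V v))"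
    using fin by (intro sum_mono card_mono) (auto simp: charged_def)
  also have "\<dots> \<le> (\<Sum>v\<in>V. card (charged V v))"
    using fin by (intro sum_mono2) auto
  finally show "length (queries ans (learn_tree V))
      \<le> (card V - 1) + 2 * (\<Sum>v\<in>V. card (charged V v))"
    using qs\<^sub>2(3) qs\<^sub>1(2) xs by (simp add: q distinct_card[symmetric])
qed

end

section \<open>Directed rooted trees\<close>

lemma pawalk_verts_eq: "pcas u p v \<Longrightarrow> pawalk_verts u p = u # map snd p"
  by (induction p arbitrary: u) auto

lemma apath_with_proj_iff:
  "pre_digraph.apath (with_proj G) u p v \<longleftrightarrow>
     u \<in> pverts G \<and> set p \<subseteq> parcs G \<and> pcas u p v \<and> distinct (u # map snd p)"
  unfolding pre_digraph.apath_def pre_digraph.awalk_def cas_with_proj_eq awalk_verts_with_proj_eq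
  by (cases "pcas u p v") (simp_all add: pawalk_verts_eq)

lemma pcas_append: "pcas u (p @ q) v \<longleftrightarrow> (\<exists>w. pcas u p w \<and> pcas w q v)"
  by (induction p arbitrary: u) auto

lemma pcas_last: "pcas u p v \<Longrightarrow> v \<in> set (u # map snd p)"
  by (induction p arbitrary: u) auto

section \<open>Parents, reachability and acyclicity in a directed rooted tree\<close>

context
  fixes T :: "'v pair_pre_digraph" and r :: 'v
  assumes tree: "directed_rooted_tree T r"
begin

interpretation pair_digraph T
  using tree by (simp add: directed_rooted_tree_def)

lemma tree_root: "r \<in> pverts T"
  using tree by (simp add: directed_rooted_tree_def)

lemma tree_symmetric_apath:
  assumes "v \<in> pverts T"
  obtains p where "pre_digraph.apath (with_proj (mk_symmetric (with_proj T))) r p v"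
proof -
  interpret H: pair_fin_digraph "mk_symmetric (with_proj T)"
    using pair_fin_digraph_mk_symmetric .
  have "r \<rightarrow>\<^sup>*\<^bsub>with_proj (mk_symmetric (with_proj T))\<^esub> v"
    using tree assms
    by (auto simp: directed_rooted_tree_def underlying_tree_def connected_def strongly_connected_def)
  then show ?thesis using that H.reachable_apath by blast
qed

lemma tree_arc_in_apath:
  assumes "(u, v) \<in> parcs T" and "pre_digraph.apath (with_proj (mk_symmetric (with_proj T))) r p v"
  shows "(u, v) \<in> set p"
  using tree assms by (fastforce simp: directed_rooted_tree_def oriented_away_def)

text \<open>Both arcs lie on one simple undirected path from \<open>r\<close> to \<open>v\<close>,
  and the heads of its arcs are distinct.\<close>

lemma tree_parent_unique:
  assumes "(u, v) \<in> parcs T" and "(u', v) \<in> parcs T"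
  shows "u = u'"
proof -
  obtain p where p: "pre_digraph.apath (with_proj (mk_symmetric (with_proj T))) r p v"
    using tree_symmetric_apath assms(1) in_arcsD2 by blast
  then have "inj_on snd (set p)" by (simp add: apath_with_proj_iff distinct_map)
  from this _ tree_arc_in_apath[OF assms(1) p] tree_arc_in_apath[OF assms(2) p] have "(u, v) = (u', v)"
    by (rule inj_onD) simp_all
  then show ?thesis by simp
qed

text \<open>The empty path from \<open>r\<close> to \<open>r\<close> would have to contain such an
  arc.\<close>

lemma tree_root_no_parent: "(u, r) \<notin> parcs T"
  using tree_arc_in_apath[of u r "[]"] tree_root by (auto simp: apath_with_proj_iff)

text \<open>
  If the last step \<open>(u, v)\<close> of an undirected path from \<open>r\<close> were an arc \<open>(v, u)\<close>, then the path up
  to \<open>u\<close> would have to use that arc, and so visit \<open>v\<close> too early.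
\<close>

lemma symmetric_apath_imp_reachable:
  assumes "pre_digraph.apath (with_proj (mk_symmetric (with_proj T))) r p v"
  shows "(r, v) \<in> (parcs T)\<^sup>*"
  using assms
proof (induction p arbitrary: v rule: rev_induct)
  case Nil
  then show ?case by (simp add: apath_with_proj_iff)
next
  case (snoc e p)
  obtain u where e: "e = (u, v)" and p: "pcas r p u"
    using snoc.prems by (cases e) (auto simp: apath_with_proj_iff pcas_append)
  have ap: "pre_digraph.apath (with_proj (mk_symmetric (with_proj T))) r p u"
    using snoc.prems p by (auto simp: apath_with_proj_iff)
  have "v \<notin> set (r # map snd p)"
    using snoc.prems by (auto simp: apath_with_proj_iff e)
  moreover have "v \<in> set (r # map snd p)" if vu: "(v, u) \<in> set p"
  proof -
    obtain ys zs where eq: "p = ys @ (v, u) # zs" using vu by (meson split_list)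
    then have "pcas r ys v" using p by (auto simp: pcas_append)
    then show ?thesis using pcas_last by (fastforce simp: eq)
  qed
  ultimately have "(v, u) \<notin> parcs T" using tree_arc_in_apath[OF _ ap] by blast
  moreover have "(u, v) \<in> parcs (mk_symmetric (with_proj T))"
    using snoc.prems unfolding apath_with_proj_iff e by auto
  ultimately have "(u, v) \<in> parcs T" by (auto simp: parcs_mk_symmetric)
  then show ?case using snoc.IH[OF ap] by (rule rtrancl_into_rtrancl[rotated])
qed

lemma tree_reachable: "v \<in> pverts T \<Longrightarrow> (r, v) \<in> (parcs T)\<^sup>*"
  using tree_symmetric_apath symmetric_apath_imp_reachable by blast

text \<open>A cycle through \<open>v\<close> also passes through the unique parent of
  \<open>v\<close>. Moving up in this way, it would reach the root, which has no parent.\<close>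

lemma tree_acyclic: "acyclic (parcs T)"
proof (rule acyclicI, intro allI notI)
  fix v assume v: "(v, v) \<in> (parcs T)\<^sup>+"
  then have "v \<in> pverts T" by (meson in_arcsD1 tranclD)
  then have "(r, v) \<in> (parcs T)\<^sup>*" by (rule tree_reachable)
  then have "(v, v) \<notin> (parcs T)\<^sup>+"
  proof induction
    case base
    show ?case using tree_root_no_parent by (meson tranclD2)
  next
    case (step u v)
    show ?case
    proof
      assume "(v, v) \<in> (parcs T)\<^sup>+"
      then have "(v, u) \<in> (parcs T)\<^sup>*" using step.hyps(2) tree_parent_unique by (metis tranclD2)
      then have "(u, u) \<in> (parcs T)\<^sup>+" using step.hyps(2) by (rule rtrancl_into_trancl2[rotated])
      then show False using step.IH by blast
    qed
  qed
  then show False using v by blast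
qed

text \<open>Library reachability is reflexive only at vertices, the reflexive transitive closure
  everywhere; hence the hypothesis on \<open>u\<close>.\<close>

lemma path_query_iff:
  "u \<in> pverts T \<Longrightarrow> path_query T u v \<longleftrightarrow> (u, v) \<in> (parcs T)\<^sup>*"
  unfolding path_query_def
  using reachable1_reachable[of u v] reachable_refl[of u] reachable_rtranclI[of "with_proj T" u v]
  by (auto simp: rtrancl_eq_or_trancl)

lemma tree_answered_forest: "answered_forest (pverts T) (parcs T) (path_query T)"
  using in_arcsD1 in_arcsD2 tree_acyclic tree_parent_unique path_query_iff
  by unfold_locales auto

section \<open>Ancestors, height and the total charge\<close>

text \<open>Read backwards, a directed walk from the root can only follow unique parents, so it
  meets all proper ancestors of \<open>v\<close>. Its length thus bounds their number.\<close>

lemma ancestors_subset_tails: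
  assumes "pcas r p v" and "set p \<subseteq> parcs T"
  shows "{q. (q, v) \<in> (parcs T)\<^sup>+} \<subseteq> fst ` set p"
  using assms
proof (induction p arbitrary: v rule: rev_induct)
  case Nil
  then show ?case using tree_root_no_parent by (auto dest: tranclD2)
next
  case (snoc e p)
  obtain u where e: "e = (u, v)" and p: "pcas r p u"
    using snoc.prems by (cases e) (auto simp: pcas_append)
  show ?case
  proof
    fix q assume "q \<in> {q. (q, v) \<in> (parcs T)\<^sup>+}"
    then have "(q, u) \<in> (parcs T)\<^sup>*"
      using tree_parent_unique snoc.prems(2) e by (metis (no_types, lifting) in_set_conv_decomp
          mem_Collect_eq subsetD tranclD2)
    then show "q \<in> fst ` set (p @ [e])"
      using snoc.IH[OF p] snoc.prems(2) by (auto simp: rtrancl_eq_or_trancl e)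
  qed
qed

text \<open>Needed because \<open>height\<close> measures only paths that end in leaves. Descending
  along arcs terminates since the tree is finite and acyclic.\<close>

lemma exists_leaf_below:
  assumes "v \<in> pverts T"
  shows "\<exists>l. leaf T l \<and> (v, l) \<in> (parcs T)\<^sup>*"
proof -
  have "wf ((parcs T)\<inverse>)" using pair_finite_arcs tree_acyclic by (rule finite_acyclic_wf_converse)
  then show ?thesis using assms
  proof (induction v rule: wf_induct_rule)
    case (less v)
    show ?case
    proof (cases "leaf T v")
      case False
      then have "out_arcs (with_proj T) v \<noteq> {}"
        using less.prems by (auto simp: leaf_def out_degree_def)
      then obtain w where "(v, w) \<in> parcs T" by (auto simp: out_arcs_def)
      then show ?thesis
        using less.IH[of w] in_arcsD2 by (meson converse_rtrancl_into_rtrancl converse_iff)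
    qed auto
  qed
qed

lemma card_ancestors_le_height:
  assumes "v \<in> pverts T"
  shows "card {q. (q, v) \<in> (parcs T)\<^sup>+} \<le> height T r"
proof -
  obtain l where l: "leaf T l" "(v, l) \<in> (parcs T)\<^sup>*" using exists_leaf_below assms by blast
  have "path_query T r l"
    using l tree_reachable path_query_iff tree_root by (auto simp: leaf_def)
  then obtain p where p: "pre_digraph.apath (with_proj T) r p l"
    unfolding path_query_def using reachable_apath by blast
  have "{q. (q, v) \<in> (parcs T)\<^sup>+} \<subseteq> {q. (q, l) \<in> (parcs T)\<^sup>+}" using l(2) by auto
  also have "\<dots> \<subseteq> fst ` set p"
    using p by (intro ancestors_subset_tails) (auto simp: apath_with_proj_iff)
  finally have "card {q. (q, v) \<in> (parcs T)\<^sup>+} \<le> card (set p)"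
    by (meson List.finite_set card_image_le card_mono finite_imageI le_trans)
  also have "\<dots> \<le> length p" by (rule card_length)
  also have "\<dots> \<le> height T r"
    unfolding height_def
  proof (rule Max_ge)
    \<comment> \<open>Simple paths have fewer arcs than there are vertices, so \<open>Max\<close>
      ranges over a finite set.\<close>
    have "{length p | p v. leaf T v \<and> pre_digraph.apath (with_proj T) r p v}
        \<subseteq> {..<card (pverts T)}"
      using length_apath_less by auto
    then show "finite {length p | p v. leaf T v \<and> pre_digraph.apath (with_proj T) r p v}"
      using finite_subset by blast
  qed (use p l in blast)
  finally show ?thesis .
qed

text \<open>Charged vertices are children of proper ancestors of \<open>v\<close>: at most
  \<open>height T r\<close> ancestors with at most \<open>d\<close> children each.\<close>

lemma card_charged_le:
  assumes deg: "\<forall>v \<in> pverts T. degree T v \<le> d" and v: "v \<in> pverts T"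
  shows "card (answered_forest.charged (parcs T) (pverts T) v) \<le> d * height T r"
proof -
  let ?A = "{q. (q, v) \<in> (parcs T)\<^sup>+}"
  have A: "?A \<subseteq> pverts T" by (auto dest!: tranclD in_arcsD1)
  then have finA: "finite ?A" using pair_finite_verts finite_subset by blast
  have children: "card (parcs T `` {q}) \<le> d" "finite (parcs T `` {q})" if "q \<in> pverts T" for q
  proof -
    have eq: "parcs T `` {q} = snd ` out_arcs (with_proj T) q" by force
    have fin: "finite (out_arcs (with_proj T) q)" by (rule finite_out_arcs)
    show "finite (parcs T `` {q})" using fin by (simp add: eq)
    have "card (parcs T `` {q}) \<le> out_degree (with_proj T) q"
      unfolding eq out_degree_def using fin by (rule card_image_le)
    then show "card (parcs T `` {q}) \<le> d" using deg that by (fastforce simp: degree_def)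
  qed
  have "answered_forest.charged (parcs T) (pverts T) v \<subseteq> (\<Union>q\<in>?A. parcs T `` {q})"
    using answered_forest.charged_def[OF tree_answered_forest] by auto
  then have "card (answered_forest.charged (parcs T) (pverts T) v) \<le> card (\<Union>q\<in>?A. parcs T `` {q})"
    using finA A children(2) by (intro card_mono) auto
  also have "\<dots> \<le> (\<Sum>q\<in>?A. card (parcs T `` {q}))" using finA by (rule card_UN_le)
  also have "\<dots> \<le> (\<Sum>q\<in>?A. d)" using A children(1) by (intro sum_mono) auto
  also have "\<dots> \<le> d * height T r" using card_ancestors_le_height[OF v] by simp
  finally show ?thesis .
qed

text \<open>Absorbs the cost of the root search into the product bound. At height 0 the product
  vanishes, but then the tree is a single vertex.\<close>

lemma tree_card_le: "card (pverts T) - 1 \<le> card (pverts T) * height T r"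
proof (cases "pverts T = {r}")
  case False
  then obtain v where v: "v \<in> pverts T" "v \<noteq> r" using tree_root by blast
  then have "r \<in> {q. (q, v) \<in> (parcs T)\<^sup>+}"
    using tree_reachable by (auto simp: rtrancl_eq_or_trancl)
  moreover have "{q. (q, v) \<in> (parcs T)\<^sup>+} \<subseteq> pverts T" by (auto dest!: tranclD in_arcsD1)
  ultimately have "0 < card {q. (q, v) \<in> (parcs T)\<^sup>+}"
    using pair_finite_verts card_gt_0_iff finite_subset by blast
  then have "0 < height T r" using card_ancestors_le_height[OF v(1)] by simp
  then show ?thesis by (cases "height T r") auto
qed simp

lemma learn_tree_spec:
  assumes deg: "\<forall>v \<in> pverts T. degree T v \<le> d"
  shows "outcome (path_query T) (learn_tree (pverts T)) = (r, parcs T)"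
    and "set (queries (path_query T) (learn_tree (pverts T))) \<subseteq> pverts T \<times> pverts T"
    and "length (queries (path_query T) (learn_tree (pverts T)))
      \<le> (2 * d + 1) * card (pverts T) * height T r"
proof -
  interpret F: answered_forest "pverts T" "parcs T" "path_query T" by (rule tree_answered_forest)
  note correct = F.learn_tree_correct[OF pair_finite_verts tree_root tree_reachable]
  show "outcome (path_query T) (learn_tree (pverts T)) = (r, parcs T)"
    and "set (queries (path_query T) (learn_tree (pverts T))) \<subseteq> pverts T \<times> pverts T"
    using correct(1,2) by blast+
  have "(\<Sum>v\<in>pverts T. card (F.charged (pverts T) v)) \<le> (\<Sum>v\<in>pverts T. d * height T r)"
    using card_charged_le[OF deg] by (intro sum_mono) auto
  \<comment> \<open>The summand \<open>2 * d\<close> pays for the recursion, the 1 for the root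
    search.\<close>
  then show "length (queries (path_query T) (learn_tree (pverts T)))
      \<le> (2 * d + 1) * card (pverts T) * height T r"
    using correct(3) tree_card_le by (simp add: algebra_simps)
qed

end

theorem theorem1:
  shows "\<exists>A :: 'v set \<Rightarrow> 'v learner. \<forall>d :: nat. \<exists>C :: real. \<forall>(T :: 'v pair_pre_digraph) r.
    directed_rooted_tree T r \<and> (\<forall>v \<in> pverts T. degree T v \<le> d) \<longrightarrow>
      outcome (path_query T) (A (pverts T)) = (r, parcs T) \<and>
      set (queries (path_query T) (A (pverts T))) \<subseteq> pverts T \<times> pverts T \<and>
      real (length (queries (path_query T) (A (pverts T))))
        \<le> C * real (card (pverts T)) * real (height T r)"
\<comment> \<open>The learner is fixed before \<open>d\<close>. The constant stays schematic until
  the final \<open>show\<close> sets it to \<open>real (2 * d + 1)\<close>.\<close>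
proof (rule exI[of _ learn_tree], rule allI, rule exI, intro allI impI)
  fix d :: nat and T :: "'v pair_pre_digraph" and r
  assume "directed_rooted_tree T r \<and> (\<forall>v \<in> pverts T. degree T v \<le> d)"
  then have tree: "directed_rooted_tree T r" and deg: "\<forall>v \<in> pverts T. degree T v \<le> d" by auto
  have "real (length (queries (path_query T) (learn_tree (pverts T))))
      \<le> real ((2 * d + 1) * card (pverts T) * height T r)"
    using learn_tree_spec(3)[OF tree deg] by (rule of_nat_mono)
  then show "outcome (path_query T) (learn_tree (pverts T)) = (r, parcs T) \<and>
      set (queries (path_query T) (learn_tree (pverts T))) \<subseteq> pverts T \<times> pverts T \<and>
      real (length (queries (path_query T) (learn_tree (pverts T))))
        \<le> real (2 * d + 1) * real (card (pverts T)) * real (height T r)"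
    using learn_tree_spec(1,2)[OF tree deg] by (simp only: of_nat_mult)
qed

end
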